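(* There exists a map of bisimplicial sets $f:X\to Y$ such that, for every $p\geq 0$, both simplicial maps $f_{p,*}:X_{p,*}\to Y_{p,*}$ and $f_{*,p}:X_{*,p}\to Y_{*,p}$ are Kan fibrations, but the induced map of diagonal simplicial sets $\operatorname{diag} f:\operatorname{diag} X\to\operatorname{diag} Y$ is not a Kan fibration.
   Context: $\Delta$ denotes the category of the finite ordered sets $[n]=\{0,1,\ldots,n\}$, $n\geq 0$, with weakly order-preserving maps. A simplicial set is a functor $\Delta^{op}\to\mathrm{Set}$. A bisimplicial set is a functor $X:\Delta^{op}\times\Delta^{op}\to\mathrm{Set}$, $([p],[q])\mapsto X_{p,q}$, and a bisimplicial map is a natural transformation of such functors. For a bisimplicial set $X$ and fixed $p\geq 0$, $X_{p,*}$ is the simplicial set $[q]\mapsto X_{p,q}$ and $X_{*,p}$ is the simplicial set $[q]\mapsto X_{q,p}$; $f_{p,*}$ and $f_{*,p}$ are the simplicial maps with components $f_{p,q}$ and $f_{q,p}$, $q\geq 0$, respectively. The diagonal $\operatorname{diag}X$ is the simplicial set $[n]\mapsto X_{n,n}$, obtained by composing $X$ with the diagonal functor $\Delta^{op}\to\Delta^{op}\times\Delta^{op}$, and $\operatorname{diag} f$ is the simplicial map with components $f_{n,n}$. A simplicial map $g:A\to B$ is a Kan fibration if for all $n\geq 1$, all $0\leq k\leq n$, and all simplices $x_0,\ldots,x_{k-1},x_{k+1},\ldots,x_n\in A_{n-1}$ and $y\in B_n$ such that $d_ix_j=d_{j-1}x_i$ for all $i<j$ with $i\neq k\neq j$ and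 $d_iy=g(x_i)$ for all $i\neq k$, there is a simplex $x\in A_n$ with $d_ix=x_i$ for all $i\neq k$ and $g(x)=y$. *)

theory Defs
  imports Main "HOL-Library.FuncSet"
begin

text \<open>
  Morphisms of the simplex category are extensional functions, so that equality of
  morphisms from \<open>[m]\<close> to \<open>[n]\<close> is equality in HOL; composition is
  \<^term>\<open>compose {..m}\<close>.
\<close>

definition Delta :: "nat \<Rightarrow> nat \<Rightarrow> (nat \<Rightarrow> nat) set" where
  "Delta m n = {\<alpha> \<in> {..m} \<rightarrow>\<^sub>E {..n}. mono_on {..m} \<alpha>}"

definition Delta_id :: "nat \<Rightarrow> nat \<Rightarrow> nat" where
  "Delta_id n = (\<lambda>i\<in>{..n}. i)"

text \<open>
  For \<open>\<alpha> : [m] \<rightarrow> [n]\<close>, the map \<open>act X m n \<alpha>\<close> goes from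
  \<open>simplices X n\<close> to \<open>simplices X m\<close>. Values outside the carriers, or at functions
  that are not morphisms, are irrelevant.
\<close>

record 'a sset =
  simplices :: "nat \<Rightarrow> 'a set"
  act :: "nat \<Rightarrow> nat \<Rightarrow> (nat \<Rightarrow> nat) \<Rightarrow> 'a \<Rightarrow> 'a"

definition simplicial_set :: "'a sset \<Rightarrow> bool" where
  "simplicial_set A \<longleftrightarrow>
    (\<forall>m n. \<forall>\<alpha>\<in>Delta m n. act A m n \<alpha> \<in> simplices A n \<rightarrow> simplices A m) \<and>
    (\<forall>n. \<forall>x\<in>simplices A n. act A n n (Delta_id n) x = x) \<and>
    (\<forall>l m n. \<forall>\<beta>\<in>Delta l m. \<forall>\<alpha>\<in>Delta m n. \<forall>x\<in>simplices A n.
      act A l n (compose {..l} \<alpha> \<beta>) x = act A l m \<beta> (act A m n \<alpha> x))"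

definition simplicial_map :: "'a sset \<Rightarrow> 'b sset \<Rightarrow> (nat \<Rightarrow> 'a \<Rightarrow> 'b) \<Rightarrow> bool" where
  "simplicial_map A B g \<longleftrightarrow>
    (\<forall>n. g n \<in> simplices A n \<rightarrow> simplices B n) \<and>
    (\<forall>m n. \<forall>\<alpha>\<in>Delta m n. \<forall>x\<in>simplices A n.
      g m (act A m n \<alpha> x) = act B m n \<alpha> (g n x))"

text \<open>
  The injection from \<open>[n - 1]\<close> to \<open>[n]\<close> omitting \<open>i\<close>, for \<open>n \<ge> 1\<close>, and the face
  operator \<open>d\<^sub>i\<close> on \<open>n\<close>-simplices that it induces.
\<close>

definition coface :: "nat \<Rightarrow> nat \<Rightarrow> nat \<Rightarrow> nat" where
  "coface n i = (\<lambda>j\<in>{..n - 1}. if j < i then j else Suc j)"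

definition face :: "'a sset \<Rightarrow> nat \<Rightarrow> nat \<Rightarrow> 'a \<Rightarrow> 'a" where
  "face A n i = act A (n - 1) n (coface n i)"

text \<open>
  To be applied to simplicial maps \<open>g\<close> between simplicial sets. The value \<open>x k\<close> is
  unconstrained. If \<open>n = 1\<close>, the matching condition on the \<open>x i\<close> is vacuous, so
  no face of a \<open>0\<close>-simplex is ever used.
\<close>

definition kan_fibration :: "'a sset \<Rightarrow> 'b sset \<Rightarrow> (nat \<Rightarrow> 'a \<Rightarrow> 'b) \<Rightarrow> bool" where
  "kan_fibration A B g \<longleftrightarrow>
    (\<forall>n\<ge>1. \<forall>k\<le>n. \<forall>x. \<forall>y\<in>simplices B n.
      (\<forall>i\<le>n. i \<noteq> k \<longrightarrow> x i \<in> simplices A (n - 1)) \<longrightarrow>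
      (\<forall>i j. i < j \<longrightarrow> j \<le> n \<longrightarrow> i \<noteq> k \<longrightarrow> j \<noteq> k \<longrightarrow>
        face A (n - 1) i (x j) = face A (n - 1) (j - 1) (x i)) \<longrightarrow>
      (\<forall>i\<le>n. i \<noteq> k \<longrightarrow> face B n i y = g (n - 1) (x i)) \<longrightarrow>
      (\<exists>z\<in>simplices A n. (\<forall>i\<le>n. i \<noteq> k \<longrightarrow> face A n i z = x i) \<and> g n z = y))"

text \<open>
  For \<open>\<alpha> : [p'] \<rightarrow> [p]\<close> and \<open>\<beta> : [q'] \<rightarrow> [q]\<close>, the map
  \<open>biact X p' p q' q \<alpha> \<beta>\<close> goes from \<open>bisimplices X p q\<close> to \<open>bisimplices X p' q'\<close>.
\<close>

record 'a bisset =
  bisimplices :: "nat \<Rightarrow> nat \<Rightarrow> 'a set"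
  biact :: "nat \<Rightarrow> nat \<Rightarrow> nat \<Rightarrow> nat \<Rightarrow> (nat \<Rightarrow> nat) \<Rightarrow> (nat \<Rightarrow> nat) \<Rightarrow> 'a \<Rightarrow> 'a"

definition bisimplicial_set :: "'a bisset \<Rightarrow> bool" where
  "bisimplicial_set X \<longleftrightarrow>
    (\<forall>p' p q' q. \<forall>\<alpha>\<in>Delta p' p. \<forall>\<beta>\<in>Delta q' q.
      biact X p' p q' q \<alpha> \<beta> \<in> bisimplices X p q \<rightarrow> bisimplices X p' q') \<and>
    (\<forall>p q. \<forall>x\<in>bisimplices X p q. biact X p p q q (Delta_id p) (Delta_id q) x = x) \<and>
    (\<forall>p'' p' p q'' q' q. \<forall>\<alpha>'\<in>Delta p'' p'. \<forall>\<alpha>\<in>Delta p' p.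
      \<forall>\<beta>'\<in>Delta q'' q'. \<forall>\<beta>\<in>Delta q' q. \<forall>x\<in>bisimplices X p q.
      biact X p'' p q'' q (compose {..p''} \<alpha> \<alpha>') (compose {..q''} \<beta> \<beta>') x =
      biact X p'' p' q'' q' \<alpha>' \<beta>' (biact X p' p q' q \<alpha> \<beta> x))"

definition bisimplicial_map ::
    "'a bisset \<Rightarrow> 'b bisset \<Rightarrow> (nat \<Rightarrow> nat \<Rightarrow> 'a \<Rightarrow> 'b) \<Rightarrow> bool" where
  "bisimplicial_map X Y f \<longleftrightarrow>
    (\<forall>p q. f p q \<in> bisimplices X p q \<rightarrow> bisimplices Y p q) \<and>
    (\<forall>p' p q' q. \<forall>\<alpha>\<in>Delta p' p. \<forall>\<beta>\<in>Delta q' q. \<forall>x\<in>bisimplices X p q.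
      f p' q' (biact X p' p q' q \<alpha> \<beta> x) = biact Y p' p q' q \<alpha> \<beta> (f p q x))"

text \<open>\<open>X\<^sub>p\<^sub>,\<^sub>*\<close>, \<open>X\<^sub>*\<^sub>,\<^sub>p\<close> and the diagonal, on objects and on maps.\<close>

definition row :: "'a bisset \<Rightarrow> nat \<Rightarrow> 'a sset" where
  "row X p = \<lparr>simplices = (\<lambda>q. bisimplices X p q),
              act = (\<lambda>q' q \<beta>. biact X p p q' q (Delta_id p) \<beta>)\<rparr>"

definition column :: "'a bisset \<Rightarrow> nat \<Rightarrow> 'a sset" where
  "column X p = \<lparr>simplices = (\<lambda>q. bisimplices X q p),
                 act = (\<lambda>q' q \<alpha>. biact X q' q p p \<alpha> (Delta_id p))\<rparr>"

definition diag :: "'a bisset \<Rightarrow> 'a sset" where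
  "diag X = \<lparr>simplices = (\<lambda>n. bisimplices X n n),
             act = (\<lambda>m n \<alpha>. biact X m n m n \<alpha> \<alpha>)\<rparr>"

definition row_map :: "(nat \<Rightarrow> nat \<Rightarrow> 'a \<Rightarrow> 'b) \<Rightarrow> nat \<Rightarrow> nat \<Rightarrow> 'a \<Rightarrow> 'b" where
  "row_map f p = (\<lambda>q. f p q)"

definition column_map :: "(nat \<Rightarrow> nat \<Rightarrow> 'a \<Rightarrow> 'b) \<Rightarrow> nat \<Rightarrow> nat \<Rightarrow> 'a \<Rightarrow> 'b" where
  "column_map f p = (\<lambda>q. f q p)"

definition diag_map :: "(nat \<Rightarrow> nat \<Rightarrow> 'a \<Rightarrow> 'b) \<Rightarrow> nat \<Rightarrow> 'a \<Rightarrow> 'b" where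
  "diag_map f = (\<lambda>n. f n n)"

lemma Delta_id_in_Delta: "Delta_id n \<in> Delta n n"
  by (auto simp: Delta_id_def Delta_def mono_on_def)

lemma compose_Delta_id: "compose {..n} (Delta_id n) (Delta_id n) = Delta_id n"
  by (auto simp: Delta_id_def compose_def fun_eq_iff)

lemma coface_in_Delta: "1 \<le> n \<Longrightarrow> coface n i \<in> Delta (n - 1) n"
  by (auto simp: coface_def Delta_def mono_on_def)

lemma simplicial_set_row: "bisimplicial_set X \<Longrightarrow> simplicial_set (row X p)"
  unfolding bisimplicial_set_def simplicial_set_def row_def
  by (simp add: Delta_id_in_Delta) (metis Delta_id_in_Delta compose_Delta_id)

lemma simplicial_set_column: "bisimplicial_set X \<Longrightarrow> simplicial_set (column X p)"
  unfolding bisimplicial_set_def simplicial_set_def column_def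
  by (simp add: Delta_id_in_Delta) (metis Delta_id_in_Delta compose_Delta_id)

lemma simplicial_set_diag: "bisimplicial_set X \<Longrightarrow> simplicial_set (diag X)"
  unfolding bisimplicial_set_def simplicial_set_def diag_def by simp

lemma simplicial_map_row:
  "bisimplicial_map X Y f \<Longrightarrow> simplicial_map (row X p) (row Y p) (row_map f p)"
  unfolding bisimplicial_map_def simplicial_map_def row_def row_map_def
  by (simp add: Delta_id_in_Delta)

lemma simplicial_map_column:
  "bisimplicial_map X Y f \<Longrightarrow> simplicial_map (column X p) (column Y p) (column_map f p)"
  unfolding bisimplicial_map_def simplicial_map_def column_def column_map_def
  by (simp add: Delta_id_in_Delta)

lemma simplicial_map_diag:
  "bisimplicial_map X Y f \<Longrightarrow> simplicial_map (diag X) (diag Y) (diag_map f)"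
  unfolding bisimplicial_map_def simplicial_map_def diag_def diag_map_def by simp

end

theory Submission
  imports Defs "HOL-Library.Nat_Bijection"
begin

text \<open>
  Let \<open>K\<close> be the simplicial set whose \<open>n\<close>-simplices are the subsets of \<open>[n]\<close>, with
  \<open>\<alpha>\<close> acting by preimage: the nerve of the contractible groupoid on two objects. It is a
  Kan complex because a subset of \<open>[n]\<close> is determined vertex by vertex, and the faces of a
  horn agree on the vertices they share. Point \<open>K\<close> by the empty subset and let
  \<open>X\<^sub>p\<^sub>,\<^sub>q\<close> be the wedge \<open>K\<^sub>p \<or> K\<^sub>q\<close>, that is, the pairs \<open>(a, b)\<close> of subsets of
  \<open>[p]\<close> and \<open>[q]\<close> of which at least one is empty. The base \<open>Y\<close> is a point.

  In a row only \<open>b\<close> varies, so the row splits as a disjoint union over \<open>a\<close>: a copy of \<open>K\<close>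
  for \<open>a\<close> empty and an isolated point for every other \<open>a\<close>. Such a disjoint union is a Kan
  complex, and columns are the same with the two components exchanged. The diagonal, however,
  is the wedge \<open>K \<or> K\<close> of simplicial sets. A nonconstant edge of the first copy that ends at
  the wedge point, followed by a nonconstant edge of the second copy that starts there, is a
  horn in dimension 2; a filler would have both components nonempty.

  As the simplices have to be natural numbers, pairs of finite sets are encoded as numbers.
\<close>

section \<open>Filling horns of subsets\<close>

definition preim :: "nat \<Rightarrow> (nat \<Rightarrow> nat) \<Rightarrow> nat set \<Rightarrow> nat set" where
  "preim m \<alpha> S = {i. i \<le> m \<and> \<alpha> i \<in> S}"

lemma preim_subset: "preim m \<alpha> S \<subseteq> {..m}"
  by (auto simp: preim_def)

lemma preim_empty [simp]: "preim m \<alpha> {} = {}"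
  by (simp add: preim_def)

lemma preim_Delta_id: "S \<subseteq> {..n} \<Longrightarrow> preim n (Delta_id n) S = S"
  by (auto simp: preim_def Delta_id_def)

lemma preim_compose:
  "\<beta> \<in> Delta l m \<Longrightarrow> preim l (compose {..l} \<alpha> \<beta>) S = preim l \<beta> (preim m \<alpha> S)"
  by (auto simp: preim_def compose_def Delta_def)

lemma finite_preim [simp]: "finite (preim m \<alpha> S)"
  by (rule finite_subset[OF preim_subset]) simp

text \<open>
  The vertex \<open>v \<noteq> i\<close> of \<open>[n]\<close> has this number as a vertex of the \<open>i\<close>-th face.
\<close>

definition face_vertex :: "nat \<Rightarrow> nat \<Rightarrow> nat" where
  "face_vertex i v = (if v < i then v else v - 1)"

text \<open>
  A vertex lying on two faces of a horn lies on their common face, where the matching condition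
  compares its memberships. The three indices \<open>i\<close>, \<open>j\<close>, \<open>v\<close> being distinct forces
  \<open>n \<ge> 2\<close>, so the face operators in dimension \<open>n - 1\<close> are genuine.
\<close>

lemma horn_vertex_consistent:
  assumes match: "preim (n - 1 - 1) (coface (n - 1) i) (S j)
                  = preim (n - 1 - 1) (coface (n - 1) (j - 1)) (S i)"
    and "i < j" "j \<le> n" "v \<le> n" "v \<noteq> i" "v \<noteq> j"
  shows "face_vertex i v \<in> S i \<longleftrightarrow> face_vertex j v \<in> S j"
proof -
  define u where "u = face_vertex i (face_vertex j v)"
  have "2 \<le> n" "1 \<le> j"
    using assms(2-) by auto
  then obtain m l where nj: "n = Suc (Suc m)" "j = Suc l"
    by (metis Suc_le_D One_nat_def numeral_2_eq_2 Suc_le_mono)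
  consider "v < i" | w where "v = Suc w" "i \<le> w" "w < l"
    | w where "v = Suc (Suc w)" "l \<le> w"
    using assms(2-) unfolding nj by (cases v; cases "v - 1") (force simp: not_less)+
  then have "u \<le> n - 1 - 1 \<and> coface (n - 1) i u = face_vertex j v
      \<and> coface (n - 1) (j - 1) u = face_vertex i v"
    using assms(2-4) by cases (auto simp: nj u_def face_vertex_def coface_def)
  moreover have "u \<in> preim (n - 1 - 1) (coface (n - 1) i) (S j)
      \<longleftrightarrow> u \<in> preim (n - 1 - 1) (coface (n - 1) (j - 1)) (S i)"
    using match by simp
  ultimately show ?thesis
    by (simp add: preim_def)
qed

text \<open>
  The union of the given faces is a filler. The last clause makes it compatible with the wedge:
  a horn at the base point has a filler at the base point.
\<close>

lemma subset_horn_filler: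
  fixes S :: "nat \<Rightarrow> nat set"
  assumes "1 \<le> n"
    and sub: "\<And>i. i \<le> n \<Longrightarrow> i \<noteq> k \<Longrightarrow> S i \<subseteq> {..n - 1}"
    and match: "\<And>i j. i < j \<Longrightarrow> j \<le> n \<Longrightarrow> i \<noteq> k \<Longrightarrow> j \<noteq> k \<Longrightarrow>
      preim (n - 1 - 1) (coface (n - 1) i) (S j)
      = preim (n - 1 - 1) (coface (n - 1) (j - 1)) (S i)"
  obtains T where "T \<subseteq> {..n}"
    and "\<And>i. i \<le> n \<Longrightarrow> i \<noteq> k \<Longrightarrow> preim (n - 1) (coface n i) T = S i"
    and "(\<And>i. i \<le> n \<Longrightarrow> i \<noteq> k \<Longrightarrow> S i = {}) \<Longrightarrow> T = {}"
proof
  define T where "T = {v. v \<le> n \<and> (\<exists>i\<le>n. i \<noteq> k \<and> i \<noteq> v \<and> face_vertex i v \<in> S i)}"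
  show "T \<subseteq> {..n}"
    by (auto simp: T_def)
  show "T = {}" if "\<And>i. i \<le> n \<Longrightarrow> i \<noteq> k \<Longrightarrow> S i = {}"
    using that by (auto simp: T_def)
  show "preim (n - 1) (coface n i) T = S i" if i: "i \<le> n" "i \<noteq> k" for i
  proof -
    have T_iff: "v \<in> T \<longleftrightarrow> face_vertex i v \<in> S i" if v: "v \<le> n" "v \<noteq> i" for v
    proof -
      have "face_vertex i v \<in> S i" if "j \<le> n" "j \<noteq> k" "j \<noteq> v" "face_vertex j v \<in> S j" for j
      proof (cases i j rule: linorder_cases)
        case less
        then show ?thesis
          using horn_vertex_consistent[where S = S, OF match[of i j]] that i v by auto
      next
        case greater
        then show ?thesis
          using horn_vertex_consistent[where S = S, OF match[of j i]] that i v by auto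
      qed (use that in auto)
      then show ?thesis
        using i v by (auto simp: T_def)
    qed
    have "coface n i u \<in> T \<longleftrightarrow> u \<in> S i" if "u \<le> n - 1" for u
    proof -
      have "coface n i u \<le> n" "coface n i u \<noteq> i" "face_vertex i (coface n i u) = u"
        using that \<open>1 \<le> n\<close> by (auto simp: coface_def face_vertex_def)
      then show ?thesis
        using T_iff by simp
    qed
    then show ?thesis
      using sub[OF i] by (auto simp: preim_def)
  qed
qed

section \<open>A row or column of the wedge\<close>

text \<open>
  Rows and columns are treated at once: \<open>U\<close> is the component that stays fixed along the row or
  column, \<open>V\<close> the one that varies, and \<open>e\<close> assembles a simplex from its components. Any two
  faces of a horn have the same \<open>U\<close>, since it is unchanged on passing to their common face.
  If it is nonempty, then every \<open>V\<close> in the horn is empty, and the filler of subsets stays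
  empty as the wedge requires.
\<close>

lemma kan_fibration_wedge_slice:
  fixes U V :: "'a \<Rightarrow> nat set" and e :: "nat set \<Rightarrow> nat set \<Rightarrow> 'a"
  assumes simplices: "\<And>n x. x \<in> simplices A n \<longleftrightarrow>
      U x \<subseteq> {..p} \<and> V x \<subseteq> {..n} \<and> (U x = {} \<or> V x = {})"
    and U_face: "\<And>n i x. x \<in> simplices A n \<Longrightarrow> U (face A n i x) = U x"
    and V_face: "\<And>n i x. x \<in> simplices A n \<Longrightarrow>
      V (face A n i x) = preim (n - 1) (coface n i) (V x)"
    and eqI: "\<And>x y. U x = U y \<Longrightarrow> V x = V y \<Longrightarrow> x = y"
    and e: "\<And>a b. finite a \<Longrightarrow> finite b \<Longrightarrow> U (e a b) = a \<and> V (e a b) = b"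
    and point: "\<And>n x y. x \<in> simplices A n \<Longrightarrow> y \<in> simplices B n \<Longrightarrow> g n x = y"
  shows "kan_fibration A B g"
  unfolding kan_fibration_def
proof (intro allI ballI impI)
  fix n k :: nat and x y
  assume "1 \<le> n" "k \<le> n" and y: "y \<in> simplices B n"
    and x: "\<forall>i\<le>n. i \<noteq> k \<longrightarrow> x i \<in> simplices A (n - 1)"
    and match: "\<forall>i j. i < j \<longrightarrow> j \<le> n \<longrightarrow> i \<noteq> k \<longrightarrow> j \<noteq> k \<longrightarrow>
      face A (n - 1) i (x j) = face A (n - 1) (j - 1) (x i)"
  have U_less: "U (x i) = U (x j)" if "i < j" "j \<le> n" "i \<noteq> k" "j \<noteq> k" for i j
  proof -
    have "x i \<in> simplices A (n - 1)" "x j \<in> simplices A (n - 1)"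
      using x that by auto
    then show ?thesis
      using that match U_face[of "x i" "n - 1" "j - 1"] U_face[of "x j" "n - 1" i] by simp
  qed
  have U_eq: "U (x i) = U (x j)" if "i \<le> n" "j \<le> n" "i \<noteq> k" "j \<noteq> k" for i j
    using U_less that by (metis linorder_neqE_nat)
  \<comment> \<open>Every horn has at least one face; it provides the fixed component of the filler.\<close>
  define h where "h = (if k = 0 then 1 else 0 :: nat)"
  have h: "h \<le> n" "h \<noteq> k"
    using \<open>1 \<le> n\<close> by (auto simp: h_def)
  define a where "a = U (x h)"
  have a: "a \<subseteq> {..p}"
    using x h simplices by (auto simp: a_def)
  then have "finite a"
    using finite_subset by blast
  have V_sub: "V (x i) \<subseteq> {..n - 1}" if "i \<le> n" "i \<noteq> k" for i
    using x simplices that by blast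
  have V_match: "preim (n - 1 - 1) (coface (n - 1) i) (V (x j))
      = preim (n - 1 - 1) (coface (n - 1) (j - 1)) (V (x i))"
    if "i < j" "j \<le> n" "i \<noteq> k" "j \<noteq> k" for i j
  proof -
    have "x i \<in> simplices A (n - 1)" "x j \<in> simplices A (n - 1)"
      using x that by auto
    then show ?thesis
      using that match V_face[of "x i" "n - 1" "j - 1"] V_face[of "x j" "n - 1" i] by simp
  qed
  obtain T where T: "T \<subseteq> {..n}"
    "\<And>i. i \<le> n \<Longrightarrow> i \<noteq> k \<Longrightarrow> preim (n - 1) (coface n i) T = V (x i)"
    "(\<And>i. i \<le> n \<Longrightarrow> i \<noteq> k \<Longrightarrow> V (x i) = {}) \<Longrightarrow> T = {}"
    using subset_horn_filler[where S = "\<lambda>i. V (x i)" and n = n and k = k, OF \<open>1 \<le> n\<close> V_sub V_match]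
    by blast
  have "finite T"
    using T(1) finite_subset by blast
  then have z: "U (e a T) = a" "V (e a T) = T"
    using e \<open>finite a\<close> by auto
  have "a = {} \<or> T = {}"
    using T(3) x simplices U_eq h unfolding a_def by metis
  then have z_in: "e a T \<in> simplices A n"
    using a T(1) by (simp add: simplices z)
  have "face A n i (e a T) = x i" if "i \<le> n" "i \<noteq> k" for i
    using that z z_in T(2) U_eq[OF that(1) h(1) that(2) h(2)]
    by (intro eqI) (simp_all add: U_face V_face a_def)
  then show "\<exists>z\<in>simplices A n. (\<forall>i\<le>n. i \<noteq> k \<longrightarrow> face A n i z = x i) \<and> g n z = y"
    using z_in point[OF z_in y] by blast
qed

section \<open>The wedge as a bisimplicial set of natural numbers\<close>

definition encode :: "nat set \<Rightarrow> nat set \<Rightarrow> nat" where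
  "encode a b = prod_encode (set_encode a, set_encode b)"

definition fst_set :: "nat \<Rightarrow> nat set" where
  "fst_set x = set_decode (fst (prod_decode x))"

definition snd_set :: "nat \<Rightarrow> nat set" where
  "snd_set x = set_decode (snd (prod_decode x))"

lemma fst_set_encode [simp]: "finite a \<Longrightarrow> fst_set (encode a b) = a"
  by (simp add: fst_set_def encode_def)

lemma snd_set_encode [simp]: "finite b \<Longrightarrow> snd_set (encode a b) = b"
  by (simp add: snd_set_def encode_def)

lemma finite_fst_set [simp]: "finite (fst_set x)"
  by (simp add: fst_set_def)

lemma finite_snd_set [simp]: "finite (snd_set x)"
  by (simp add: snd_set_def)

lemma encode_fst_snd [simp]: "encode (fst_set x) (snd_set x) = x"
  by (simp add: encode_def fst_set_def snd_set_def)

lemma eq_if_fst_snd_set: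
  assumes "fst_set x = fst_set y" "snd_set x = snd_set y"
  shows "x = y"
  using assms by (metis encode_fst_snd)

definition wedge :: "nat bisset" where
  "wedge =
    \<lparr>bisimplices = (\<lambda>p q. {x. fst_set x \<subseteq> {..p} \<and> snd_set x \<subseteq> {..q} \<and>
                              (fst_set x = {} \<or> snd_set x = {})}),
     biact = (\<lambda>p' p q' q \<alpha> \<beta> x. encode (preim p' \<alpha> (fst_set x)) (preim q' \<beta> (snd_set x)))\<rparr>"

definition point :: "nat bisset" where
  "point = \<lparr>bisimplices = (\<lambda>p q. {0}), biact = (\<lambda>p' p q' q \<alpha> \<beta> x. 0)\<rparr>"

lemma bisimplicial_set_wedge: "bisimplicial_set wedge"
  unfolding bisimplicial_set_def wedge_def
  by (auto simp: preim_Delta_id preim_compose dest: subsetD[OF preim_subset])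

lemma bisimplicial_set_point: "bisimplicial_set point"
  by (simp add: bisimplicial_set_def point_def)

lemma bisimplicial_map_point: "bisimplicial_map wedge point (\<lambda>p q x. 0)"
  by (simp add: bisimplicial_map_def point_def)

lemma kan_fibration_row_wedge:
  "kan_fibration (row wedge p) (row point p) (row_map (\<lambda>p q x. 0) p)"
  by (rule kan_fibration_wedge_slice
        [where U = fst_set and V = snd_set and e = encode and p = p])
    (auto simp: row_def row_map_def wedge_def point_def face_def preim_Delta_id
      intro: eq_if_fst_snd_set)

lemma kan_fibration_column_wedge:
  "kan_fibration (column wedge p) (column point p) (column_map (\<lambda>p q x. 0) p)"
  by (rule kan_fibration_wedge_slice
        [where U = snd_set and V = fst_set and e = "\<lambda>a b. encode b a" and p = p])
    (auto simp: column_def column_map_def wedge_def point_def face_def preim_Delta_id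
      intro: eq_if_fst_snd_set)

text \<open>
  The horn at the middle vertex: its face \<open>d\<^sub>2\<close>, on the vertices 0 and 1, contains vertex 0 in
  the first component only, and its face \<open>d\<^sub>0\<close>, on the vertices 1 and 2, contains vertex 2
  (numbered 1 there) in the second component only. There is one matching condition, at vertex 1,
  where both components of both faces are empty.
\<close>

lemma not_kan_fibration_diag_wedge:
  "\<not> kan_fibration (diag wedge) (diag point) (diag_map (\<lambda>p q x. 0))"
proof
  assume kan: "kan_fibration (diag wedge) (diag point) (diag_map (\<lambda>p q x. 0))"
  define x where "x i = (if i = 2 then encode {0} {} else encode {} {1})" for i :: nat
  have face_diag: "face (diag wedge) n i z =
      encode (preim (n - 1) (coface n i) (fst_set z)) (preim (n - 1) (coface n i) (snd_set z))"
    for n i z by (simp add: face_def diag_def wedge_def)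
  have x_in: "x i \<in> simplices (diag wedge) (2 - 1)" for i
    by (simp add: x_def diag_def wedge_def)
  have match: "face (diag wedge) (2 - 1) i (x j) = face (diag wedge) (2 - 1) (j - 1) (x i)"
    if "i < j" "j \<le> 2" "i \<noteq> 1" "j \<noteq> 1" for i j
  proof -
    have "i = 0" "j = 2"
      using that by auto
    then show ?thesis
      by (auto simp: face_diag x_def preim_def coface_def intro!: arg_cong2[where f = encode])
  qed
  have "\<exists>z\<in>simplices (diag wedge) 2.
      (\<forall>i\<le>2. i \<noteq> 1 \<longrightarrow> face (diag wedge) 2 i z = x i) \<and> diag_map (\<lambda>p q x. 0) 2 z = (0 :: nat)"
    using kan[unfolded kan_fibration_def, rule_format, of 2 1 0 x] x_in match
    by (simp add: diag_def point_def face_def diag_map_def)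
  then obtain z where z: "z \<in> simplices (diag wedge) 2"
    and d0: "face (diag wedge) 2 0 z = x 0" and d2: "face (diag wedge) 2 2 z = x 2"
    by fastforce
  have "preim 1 (coface 2 2) (fst_set z) = {0}"
    using arg_cong[OF d2, of fst_set] by (simp add: face_diag x_def)
  moreover have "preim 1 (coface 2 0) (snd_set z) = {1}"
    using arg_cong[OF d0, of snd_set] by (simp add: face_diag x_def)
  ultimately have "fst_set z \<noteq> {}" "snd_set z \<noteq> {}"
    by auto
  then show False
    using z by (simp add: diag_def wedge_def)
qed

theorem mainTheorem2:
  "\<exists>(X :: nat bisset) (Y :: nat bisset) f.
     bisimplicial_set X \<and> bisimplicial_set Y \<and> bisimplicial_map X Y f \<and>
     (\<forall>p. kan_fibration (row X p) (row Y p) (row_map f p) \<and>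
          kan_fibration (column X p) (column Y p) (column_map f p)) \<and>
     \<not> kan_fibration (diag X) (diag Y) (diag_map f)"
  using bisimplicial_set_wedge bisimplicial_set_point bisimplicial_map_point
    kan_fibration_row_wedge kan_fibration_column_wedge not_kan_fibration_diag_wedge
  by blast

end
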